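(* Let $D_0>0$ and let $(\theta_1^\star,\theta_2^\star,s^\star,r^\star)$ be the similarity solution (S$^\star$) of the temperature problem (P$^\star$), with associated parameter $\xi^\star$. Let $D_\infty>D_0$ and set $$h_0=\frac{k_1D_0}{\sqrt{\pi\alpha_1}\,(D_\infty-D_0)\operatorname{erf}(\xi^\star)}>0.$$ Then the solution (S$^\star$) of (P$^\star$) coincides with the similarity solution (S) of the convective problem (P) with these values of $D_\infty$ and $h_0$. Moreover, $\xi^\star$ satisfies $$\operatorname{erf}(\xi^\star)<\min\left\{1,\frac{2D_\infty D_0\,\eta}{\gamma(D_\infty-D_0)\sqrt{\pi\alpha_{12}}}\right\},$$ where $\eta$ is the only solution of the equation $F_3(x)=0$, $x>0$.
   Context: Parameters: $\rho,k_1,k_2,c_1,c_2,l,\gamma,\theta_0>0$ and $0<\epsilon<1$ are real constants; $\alpha_i=\frac{k_i}{\rho c_i}$ for $i=1,2$, and $\alpha_{12}=\frac{\alpha_1}{\alpha_2}$. As usual $\operatorname{erf}(x)=\frac{2}{\sqrt\pi}\int_0^x e^{-y^2}\,dy$ and $\operatorname{erfc}=1-\operatorname{erf}$. Common equations (C): $\alpha_1\theta_{1,xx}=\theta_{1,t}$ for $0<x<s(t)$, $t>0$; $\alpha_2\theta_{2,xx}=\theta_{2,t}$ for $x>r(t)$, $t>0$; $s(0)=r(0)=0$; $\theta_1(s(t),t)=\theta_2(r(t),t)=0$ for $t>0$; $\theta_2(x,0)=\theta_2(+\infty,t)=\theta_0$ for $x>0,t>0$; $k_1\theta_{1,x}(s(t),t)-k_2\theta_{2,x}(r(t),t)=\rho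 l[\epsilon\dot s(t)+(1-\epsilon)\dot r(t)]$ for $t>0$; $\theta_{1,x}(s(t),t)(r(t)-s(t))=\gamma$ for $t>0$. Boundary, initial and infinite values are understood as limits. Problem (P$^\star$), for a constant $D_0>0$: (C) together with $\theta_1(0,t)=-D_0$ for $t>0$. Problem (P), for constants $D_\infty,h_0>0$: (C) together with $k_1\theta_{1,x}(0,t)=\frac{h_0}{\sqrt t}(\theta_1(0,t)+D_\infty)$ for $t>0$. Functions for (P$^\star$), $x>0$: $$W_0(x)=x+\frac{\gamma\sqrt\pi}{2D_0}e^{x^2}\operatorname{erf}(x),\qquad G_0(x)=x+\frac{(1-\epsilon)\gamma\sqrt\pi}{2D_0}e^{x^2}\operatorname{erf}(x),$$ $$F_0(x)=\frac{e^{-x^2}}{\operatorname{erf}(x)}-\frac{\theta_0\sqrt{k_2c_2}}{D_0\sqrt{k_1c_1}}\frac{\exp(-\alpha_{12}W_0^2(x))}{\operatorname{erfc}(\sqrt{\alpha_{12}}W_0(x))}.$$ Solution (S$^\star$) of (P$^\star$): with $\xi^\star$ the only positive solution of $F_0(x)=\frac{l\sqrt\pi}{D_0c_1}G_0(x)$ (known to exist and be unique) and $\mu^\star=\sqrt{\alpha_{12}}W_0(\xi^\star)$: $\theta_1^\star(x,t)=-D_0\left(1-\frac{\operatorname{erf}(x/(2\sqrt{\alpha_1t}))}{\operatorname{erf}(\xi^\star)}\right)$ for $0<x<s^\star(t)$; $\theta_2^\star(x,t)=\frac{\theta_0\operatorname{erf}(\mu^\star)}{\operatorname{erfc}(\mu^\star)}\left(\frac{\operatorname{erf}(x/(2\sqrt{\alpha_2t}))}{\operatorname{erf}(\mu^\star)}-1\right)$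 for $x>r^\star(t)$; $s^\star(t)=2\xi^\star\sqrt{\alpha_1t}$, $r^\star(t)=2\mu^\star\sqrt{\alpha_2t}$, $t>0$. Functions for (P), $x>0$: $$W(x)=x+\frac{\gamma\sqrt\pi}{2D_\infty}e^{x^2}\left(\operatorname{erf}(x)+\frac{k_1}{h_0\sqrt{\alpha_1\pi}}\right),$$ $$F(x)=\frac{e^{-x^2}}{\operatorname{erf}(x)+\frac{k_1}{h_0\sqrt{\alpha_1\pi}}}-\frac{\theta_0\sqrt{k_2c_2}}{D_\infty\sqrt{k_1c_1}}\frac{\exp(-\alpha_{12}W^2(x))}{\operatorname{erfc}(\sqrt{\alpha_{12}}W(x))},$$ $$G(x)=x+\frac{(1-\epsilon)\gamma\sqrt\pi}{2D_\infty}e^{x^2}\left(\operatorname{erf}(x)+\frac{k_1}{h_0\sqrt{\alpha_1\pi}}\right).$$ Solution (S) of (P): with $\xi$ the positive solution of $F(x)=\frac{l\sqrt\pi}{D_\infty c_1}G(x)$ and $\mu=\sqrt{\alpha_{12}}W(\xi)$: $\theta_1(x,t)=-\frac{D_\infty\operatorname{erf}(\xi)}{\operatorname{erf}(\xi)+\frac{k_1}{h_0\sqrt{\pi\alpha_1}}}\left(1-\frac{\operatorname{erf}(x/(2\sqrt{\alpha_1t}))}{\operatorname{erf}(\xi)}\right)$ for $0<x<s(t)$; $\theta_2(x,t)=\frac{\theta_0\operatorname{erf}(\mu)}{\operatorname{erfc}(\mu)}\left(\frac{\operatorname{erf}(x/(2\sqrt{\alpha_2t}))}{\operatorname{erf}(\mu)}-1\right)$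 for $x>r(t)$; $s(t)=2\xi\sqrt{\alpha_1t}$, $r(t)=2\mu\sqrt{\alpha_2t}$, $t>0$. (That such a $\xi$ exists for the given $D_\infty,h_0$ is part of the assertion.) Finally, $F_3(x)=\frac{e^{-x^2}}{\operatorname{erfc}(x)}-\frac{\gamma k_1\sqrt\pi}{2\theta_0k_2}\frac1x+\frac{(1-\epsilon)l\sqrt\pi}{\theta_0c_2}x$ for $x>0$; it has exactly one positive zero $\eta$. *)

theory Defs
  imports "HOL-Analysis.Analysis"
begin

text \<open>The interval integral is oriented, so this is the error function on the whole real line.\<close>

definition erf :: "real \<Rightarrow> real" where
  "erf x = 2 / sqrt pi * (LBINT y=0..x. exp (- (y\<^sup>2)))"

definition erfc :: "real \<Rightarrow> real" where
  "erfc x = 1 - erf x"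

text \<open>\<open>lh\<close> is the latent heat \<open>l\<close>; \<open>gam\<close>, \<open>eps\<close> are the mushy zone coefficients
  \<open>\<gamma>\<close>, \<open>\<epsilon>\<close>; \<open>th0\<close> is the initial temperature \<open>\<theta>\<^sub>0\<close>.\<close>

record mushy_data =
  rho :: real
  k1 :: real
  k2 :: real
  c1 :: real
  c2 :: real
  lh :: real
  gam :: real
  th0 :: real
  eps :: real

definition admissible :: "mushy_data \<Rightarrow> bool" where
  "admissible P \<longleftrightarrow>
     rho P > 0 \<and> k1 P > 0 \<and> k2 P > 0 \<and> c1 P > 0 \<and> c2 P > 0 \<and>
     lh P > 0 \<and> gam P > 0 \<and> th0 P > 0 \<and> 0 < eps P \<and> eps P < 1"

definition alpha1 :: "mushy_data \<Rightarrow> real" where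
  "alpha1 P = k1 P / (rho P * c1 P)"

definition alpha2 :: "mushy_data \<Rightarrow> real" where
  "alpha2 P = k2 P / (rho P * c2 P)"

definition alpha12 :: "mushy_data \<Rightarrow> real" where
  "alpha12 P = alpha1 P / alpha2 P"

subsection \<open>The free boundary problems\<close>

definition dx :: "(real \<Rightarrow> real \<Rightarrow> real) \<Rightarrow> real \<Rightarrow> real \<Rightarrow> real" where
  "dx u x t = deriv (\<lambda>y. u y t) x"

definition dt :: "(real \<Rightarrow> real \<Rightarrow> real) \<Rightarrow> real \<Rightarrow> real \<Rightarrow> real" where
  "dt u x t = deriv (\<lambda>\<tau>. u x \<tau>) t"

definition heat_eq_at :: "real \<Rightarrow> (real \<Rightarrow> real \<Rightarrow> real) \<Rightarrow> real \<Rightarrow> real \<Rightarrow> bool" where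
  "heat_eq_at a u x t \<longleftrightarrow>
     (\<lambda>y. u y t) field_differentiable (at x) \<and>
     (\<lambda>y. dx u y t) field_differentiable (at x) \<and>
     (\<lambda>\<tau>. u x \<tau>) field_differentiable (at t) \<and>
     a * dx (dx u) x t = dt u x t"

text \<open>A candidate solution is a quadruple \<open>(\<theta>\<^sub>1, \<theta>\<^sub>2, s, r)\<close> with the temperatures taken as
  functions of \<open>x\<close> and \<open>t\<close>, in this order. Only the values of \<open>\<theta>\<^sub>1\<close> on \<open>0 < x < s t\<close>,
  those of \<open>\<theta>\<^sub>2\<close> on \<open>x > r t\<close>, and those of \<open>s\<close>, \<open>r\<close> at \<open>t > 0\<close> are meaningful;
  values at the boundary, at \<open>t = 0\<close> and at infinity are one-sided limits in the variable
  concerned, the other variable being fixed.\<close>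

type_synonym quadruple =
  "(real \<Rightarrow> real \<Rightarrow> real) \<times> (real \<Rightarrow> real \<Rightarrow> real) \<times> (real \<Rightarrow> real) \<times> (real \<Rightarrow> real)"

text \<open>In the last clause \<open>a\<close> and \<open>b\<close> are \<open>\<theta>\<^sub>1\<^sub>,\<^sub>x(s(t),t)\<close> and \<open>\<theta>\<^sub>2\<^sub>,\<^sub>x(r(t),t)\<close>.\<close>

definition common_equations :: "mushy_data \<Rightarrow> quadruple \<Rightarrow> bool" where
  "common_equations P = (\<lambda>(\<theta>1, \<theta>2, s, r).
     (\<forall>t>0. \<forall>x. 0 < x \<and> x < s t \<longrightarrow> heat_eq_at (alpha1 P) \<theta>1 x t) \<and>
     (\<forall>t>0. \<forall>x. x > r t \<longrightarrow> heat_eq_at (alpha2 P) \<theta>2 x t) \<and>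
     (s \<longlongrightarrow> 0) (at_right 0) \<and> (r \<longlongrightarrow> 0) (at_right 0) \<and>
     (\<forall>t>0. ((\<lambda>x. \<theta>1 x t) \<longlongrightarrow> 0) (at_left (s t)) \<and>
            ((\<lambda>x. \<theta>2 x t) \<longlongrightarrow> 0) (at_right (r t))) \<and>
     (\<forall>x>0. ((\<lambda>t. \<theta>2 x t) \<longlongrightarrow> th0 P) (at_right 0)) \<and>
     (\<forall>t>0. ((\<lambda>x. \<theta>2 x t) \<longlongrightarrow> th0 P) at_top) \<and>
     (\<forall>t>0. s field_differentiable (at t) \<and> r field_differentiable (at t) \<and>
        (\<exists>a b. ((\<lambda>x. dx \<theta>1 x t) \<longlongrightarrow> a) (at_left (s t)) \<and>
               ((\<lambda>x. dx \<theta>2 x t) \<longlongrightarrow> b) (at_right (r t)) \<and>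
               k1 P * a - k2 P * b
                 = rho P * lh P * (eps P * deriv s t + (1 - eps P) * deriv r t) \<and>
               a * (r t - s t) = gam P)))"

definition solves_temperature_problem :: "mushy_data \<Rightarrow> real \<Rightarrow> quadruple \<Rightarrow> bool" where
  "solves_temperature_problem P D0 = (\<lambda>(\<theta>1, \<theta>2, s, r).
     common_equations P (\<theta>1, \<theta>2, s, r) \<and>
     (\<forall>t>0. ((\<lambda>x. \<theta>1 x t) \<longlongrightarrow> - D0) (at_right 0)))"

definition solves_convective_problem :: "mushy_data \<Rightarrow> real \<Rightarrow> real \<Rightarrow> quadruple \<Rightarrow> bool" where
  "solves_convective_problem P Dinf h0 = (\<lambda>(\<theta>1, \<theta>2, s, r).
     common_equations P (\<theta>1, \<theta>2, s, r) \<and>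
     (\<forall>t>0. \<exists>a b. ((\<lambda>x. dx \<theta>1 x t) \<longlongrightarrow> a) (at_right 0) \<and>
                 ((\<lambda>x. \<theta>1 x t) \<longlongrightarrow> b) (at_right 0) \<and>
                 k1 P * a = h0 / sqrt t * (b + Dinf)))"

definition coincide :: "quadruple \<Rightarrow> quadruple \<Rightarrow> bool" where
  "coincide = (\<lambda>(\<theta>1, \<theta>2, s, r) (\<theta>1', \<theta>2', s', r').
     \<forall>t>0. s t = s' t \<and> r t = r' t \<and>
           (\<forall>x. 0 < x \<and> x < s t \<longrightarrow> \<theta>1 x t = \<theta>1' x t) \<and>
           (\<forall>x. x > r t \<longrightarrow> \<theta>2 x t = \<theta>2' x t))"

subsection \<open>The similarity solutions\<close>

definition theta2_sim :: "mushy_data \<Rightarrow> real \<Rightarrow> real \<Rightarrow> real \<Rightarrow> real" where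
  "theta2_sim P \<mu> x t =
     th0 P * erf \<mu> / erfc \<mu> * (erf (x / (2 * sqrt (alpha2 P * t))) / erf \<mu> - 1)"

definition s_sim :: "mushy_data \<Rightarrow> real \<Rightarrow> real \<Rightarrow> real" where
  "s_sim P \<xi> t = 2 * \<xi> * sqrt (alpha1 P * t)"

definition r_sim :: "mushy_data \<Rightarrow> real \<Rightarrow> real \<Rightarrow> real" where
  "r_sim P \<mu> t = 2 * \<mu> * sqrt (alpha2 P * t)"

text \<open>The temperature problem with boundary temperature \<open>- D0\<close>.\<close>

definition W0 :: "mushy_data \<Rightarrow> real \<Rightarrow> real \<Rightarrow> real" where
  "W0 P D0 x = x + gam P * sqrt pi / (2 * D0) * exp (x\<^sup>2) * erf x"

definition G0 :: "mushy_data \<Rightarrow> real \<Rightarrow> real \<Rightarrow> real" where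
  "G0 P D0 x = x + (1 - eps P) * gam P * sqrt pi / (2 * D0) * exp (x\<^sup>2) * erf x"

definition F0 :: "mushy_data \<Rightarrow> real \<Rightarrow> real \<Rightarrow> real" where
  "F0 P D0 x = exp (- (x\<^sup>2)) / erf x
     - th0 P * sqrt (k2 P * c2 P) / (D0 * sqrt (k1 P * c1 P))
       * (exp (- (alpha12 P * (W0 P D0 x)\<^sup>2)) / erfc (sqrt (alpha12 P) * W0 P D0 x))"

definition xi_eq_temperature :: "mushy_data \<Rightarrow> real \<Rightarrow> real \<Rightarrow> bool" where
  "xi_eq_temperature P D0 x \<longleftrightarrow>
     F0 P D0 x = lh P * sqrt pi / (D0 * c1 P) * G0 P D0 x"

definition theta1_temperature :: "mushy_data \<Rightarrow> real \<Rightarrow> real \<Rightarrow> real \<Rightarrow> real \<Rightarrow> real" where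
  "theta1_temperature P D0 \<xi> x t =
     - D0 * (1 - erf (x / (2 * sqrt (alpha1 P * t))) / erf \<xi>)"

definition sim_solution_temperature :: "mushy_data \<Rightarrow> real \<Rightarrow> real \<Rightarrow> quadruple" where
  "sim_solution_temperature P D0 \<xi> =
     (let \<mu> = sqrt (alpha12 P) * W0 P D0 \<xi>
      in (theta1_temperature P D0 \<xi>, theta2_sim P \<mu>, s_sim P \<xi>, r_sim P \<mu>))"

text \<open>The convective problem with bulk temperature \<open>- Dinf\<close> and heat transfer coefficient
  \<open>h0 / sqrt t\<close>.\<close>

definition W :: "mushy_data \<Rightarrow> real \<Rightarrow> real \<Rightarrow> real \<Rightarrow> real" where
  "W P Dinf h0 x = x + gam P * sqrt pi / (2 * Dinf) * exp (x\<^sup>2)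
     * (erf x + k1 P / (h0 * sqrt (alpha1 P * pi)))"

definition G :: "mushy_data \<Rightarrow> real \<Rightarrow> real \<Rightarrow> real \<Rightarrow> real" where
  "G P Dinf h0 x = x + (1 - eps P) * gam P * sqrt pi / (2 * Dinf) * exp (x\<^sup>2)
     * (erf x + k1 P / (h0 * sqrt (alpha1 P * pi)))"

definition F :: "mushy_data \<Rightarrow> real \<Rightarrow> real \<Rightarrow> real \<Rightarrow> real" where
  "F P Dinf h0 x = exp (- (x\<^sup>2)) / (erf x + k1 P / (h0 * sqrt (alpha1 P * pi)))
     - th0 P * sqrt (k2 P * c2 P) / (Dinf * sqrt (k1 P * c1 P))
       * (exp (- (alpha12 P * (W P Dinf h0 x)\<^sup>2)) / erfc (sqrt (alpha12 P) * W P Dinf h0 x))"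

definition xi_eq_convective :: "mushy_data \<Rightarrow> real \<Rightarrow> real \<Rightarrow> real \<Rightarrow> bool" where
  "xi_eq_convective P Dinf h0 x \<longleftrightarrow>
     F P Dinf h0 x = lh P * sqrt pi / (Dinf * c1 P) * G P Dinf h0 x"

definition theta1_convective ::
    "mushy_data \<Rightarrow> real \<Rightarrow> real \<Rightarrow> real \<Rightarrow> real \<Rightarrow> real \<Rightarrow> real" where
  "theta1_convective P Dinf h0 \<xi> x t =
     - (Dinf * erf \<xi> / (erf \<xi> + k1 P / (h0 * sqrt (pi * alpha1 P))))
       * (1 - erf (x / (2 * sqrt (alpha1 P * t))) / erf \<xi>)"

definition sim_solution_convective :: "mushy_data \<Rightarrow> real \<Rightarrow> real \<Rightarrow> real \<Rightarrow> quadruple" where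
  "sim_solution_convective P Dinf h0 \<xi> =
     (let \<mu> = sqrt (alpha12 P) * W P Dinf h0 \<xi>
      in (theta1_convective P Dinf h0 \<xi>, theta2_sim P \<mu>, s_sim P \<xi>, r_sim P \<mu>))"

definition F3 :: "mushy_data \<Rightarrow> real \<Rightarrow> real" where
  "F3 P x = exp (- (x\<^sup>2)) / erfc x
     - gam P * k1 P * sqrt pi / (2 * th0 P * k2 P) * (1 / x)
     + (1 - eps P) * lh P * sqrt pi / (th0 P * c2 P) * x"

end

theory Submission
  imports Defs "HOL-Probability.Distributions"
begin

text \<open>For the given \<open>h0\<close> the constant \<open>q = k\<^sub>1 / (h\<^sub>0 sqrt (\<alpha>\<^sub>1 \<pi>))\<close> satisfies
  \<open>(erf \<xi> + q) / D\<^sub>\<infinity> = erf \<xi> / D\<^sub>0\<close> at \<open>\<xi> = \<xi>\<^sup>\<star>\<close>. Hence \<open>W\<close> and \<open>G\<close> agree with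
  \<open>W\<^sub>0\<close> and \<open>G\<^sub>0\<close> there, \<open>\<xi>\<^sup>\<star>\<close> solves the equation of the convective problem, and the two
  quadruples are equal. The difference of the two sides of that equation is strictly decreasing on
  \<open>x \<ge> 0\<close>, because the inverse Mills ratio \<open>exp (- x\<^sup>2) / erfc x\<close> increases; so it is positive at
  \<open>0\<close>, where it is a negative multiple of \<open>F\<^sub>3 (sqrt \<alpha>\<^sub>1\<^sub>2 W 0)\<close>. As \<open>F\<^sub>3\<close> increases,
  \<open>sqrt \<alpha>\<^sub>1\<^sub>2 W 0 < \<eta>\<close>, which is the bound on \<open>erf \<xi>\<^sup>\<star>\<close>.\<close>

section \<open>The error function and the inverse Mills ratio\<close>

lemma has_real_derivative_erf [derivative_intros]:
  assumes "(f has_real_derivative f') (at x within S)"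
  shows "((\<lambda>x. erf (f x)) has_real_derivative 2 / sqrt pi * exp (- ((f x)\<^sup>2)) * f') (at x within S)"
proof -
  have "(erf has_real_derivative 2 / sqrt pi * exp (- (z\<^sup>2))) (at z)" for z :: real
  proof -
    \<comment> \<open>The interval contains the base point \<open>0\<close> and has \<open>z\<close>
      in its interior, so the derivative within it is the two-sided one.\<close>
    have "((\<lambda>u. LBINT y=0..u. exp (- (y\<^sup>2))) has_vector_derivative exp (- (z\<^sup>2)))
        (at z within {- \<bar>z\<bar> - 1..\<bar>z\<bar> + 1})"
      using interval_integral_FTC2[of "- \<bar>z\<bar> - 1" 0 "\<bar>z\<bar> + 1" "\<lambda>y. exp (- (y\<^sup>2))" z]
      by (simp add: zero_ereal_def continuous_intros)
    then have "((\<lambda>u. LBINT y=0..u. exp (- (y\<^sup>2))) has_real_derivative exp (- (z\<^sup>2))) (at z)"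
      by (subst (asm) at_within_Icc_at) (auto simp: has_real_derivative_iff_has_vector_derivative)
    from DERIV_cmult[OF this, of "2 / sqrt pi"] show ?thesis
      unfolding erf_def[abs_def] .
  qed
  from DERIV_chain2[OF this assms] show ?thesis .
qed

lemma erf_0 [simp]: "erf 0 = 0"
  by (simp add: erf_def zero_ereal_def)

lemma erf_strict_mono: "x < y \<Longrightarrow> erf x < erf y"
  by (rule DERIV_pos_imp_increasing, assumption)
     (auto intro!: exI derivative_eq_intros)

lemma erf_pos: "x > 0 \<Longrightarrow> erf x > 0"
  using erf_strict_mono[of 0 x] by simp

text \<open>The Gaussian integral over the half-line is \<open>sqrt pi / 2\<close>, and the
  integrals over \<open>0..y\<close> are its truncations.\<close>

lemma erf_tendsto_1: "(erf \<longlongrightarrow> 1) at_top"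
proof -
  have g: "integrable lborel (\<lambda>x::real. indicator {0..} x *\<^sub>R exp (- x\<^sup>2))"
    "(\<integral>x. indicator {0..} x *\<^sub>R exp (- x\<^sup>2) \<partial>lborel) = sqrt pi / 2"
    using gaussian_moment_0 by (auto simp: has_bochner_integral_iff)
  have "((\<lambda>y. \<integral>x. indicator {..y} x *\<^sub>R (indicator {0..} x *\<^sub>R exp (- x\<^sup>2)) \<partial>lborel)
      \<longlongrightarrow> sqrt pi / 2) at_top"
    using tendsto_integral_at_top[OF _ g(1)] unfolding g(2) by simp
  then have "((\<lambda>y::real. LBINT x=0..y. exp (- x\<^sup>2)) \<longlongrightarrow> sqrt pi / 2) at_top"
  proof (rule Lim_transform_eventually)
    show "\<forall>\<^sub>F y::real in at_top. (\<integral>x. indicator {..y} x *\<^sub>R (indicator {0..} x *\<^sub>R exp (- x\<^sup>2)) \<partial>lborel)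
        = (LBINT x=0..y. exp (- x\<^sup>2))"
      using eventually_ge_at_top[of 0]
    proof eventually_elim
      case (elim y)
      then show ?case
        unfolding zero_ereal_def
        by (subst interval_integral_Icc)
           (auto simp: set_lebesgue_integral_def indicator_def intro!: Bochner_Integration.integral_cong)
    qed
  qed
  from tendsto_mult_left[OF this, of "2 / sqrt pi"] show ?thesis
    by (simp add: erf_def[abs_def])
qed

lemma erf_less_1: "erf x < 1"
proof -
  \<comment> \<open>The limit gives only a weak bound; one step to the right of \<open>x\<close>
    leaves room for strict monotonicity.\<close>
  have "erf (x + 1) \<le> 1"
    using erf_tendsto_1
    by (rule tendsto_lowerbound)
       (auto intro!: eventually_at_top_linorderI[of "x + 1"] simp: le_less erf_strict_mono)
  then show ?thesis using erf_strict_mono[of x "x + 1"] by simp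
qed

lemma erfc_pos: "erfc x > 0"
  using erf_less_1[of x] by (simp add: erfc_def)

text \<open>The difference of the two sides is decreasing in \<open>x\<close> and vanishes at infinity.\<close>

lemma erfc_le:
  assumes "x > 0"
  shows "erfc x \<le> exp (- (x\<^sup>2)) / (sqrt pi * x)"
proof -
  define g where "g x = exp (- (x\<^sup>2)) / (sqrt pi * x) - erfc x" for x
  have d: "(g has_real_derivative - exp (- (y\<^sup>2)) / (sqrt pi * y\<^sup>2)) (at y)" if "y > 0" for y
  proof -
    have pi: "sqrt pi * (sqrt pi * w) = pi * w" for w
      by (simp flip: mult.assoc)
    show ?thesis
      unfolding g_def erfc_def using that
      by (auto intro!: derivative_eq_intros simp: field_simps power2_eq_square pi)
  qed
  have "g y \<le> g x" if "y \<ge> x" for y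
    using that
  proof (rule DERIV_nonpos_imp_nonincreasing)
    fix z assume "x \<le> z" "z \<le> y"
    with assms show "\<exists>w. (g has_real_derivative w) (at z) \<and> w \<le> 0"
      using d[of z] by (intro exI conjI) (auto intro!: divide_nonpos_nonneg)
  qed
  moreover have "(g \<longlongrightarrow> 0 - (1 - 1)) at_top"
    unfolding g_def[abs_def] erfc_def
  proof (intro tendsto_diff tendsto_const erf_tendsto_1)
    show "((\<lambda>x. exp (- (x\<^sup>2)) / (sqrt pi * x)) \<longlongrightarrow> 0) at_top"
      by real_asymp
  qed
  ultimately have "0 \<le> g x"
    by (intro tendsto_upperbound[of g 0 at_top])
       (auto intro!: eventually_at_top_linorderI[of x])
  then show ?thesis by (simp add: g_def)
qed

text \<open>The sign of the derivative is that of \<open>?e - sqrt pi * z * erfc z\<close>, which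
  \<open>erfc_le\<close> controls for z > 0; at z = 0 the second term vanishes.\<close>

lemma exp_div_erfc_mono:
  assumes "0 \<le> x" "x \<le> y"
  shows "exp (- (x\<^sup>2)) / erfc x \<le> exp (- (y\<^sup>2)) / erfc y"
  using assms(2)
proof (rule DERIV_nonneg_imp_nondecreasing)
  fix z assume z: "x \<le> z" "z \<le> y"
  let ?e = "exp (- (z\<^sup>2))"
  have "sqrt pi * z * erfc z \<le> ?e"
    using erfc_le[of z] z assms by (cases "z = 0") (auto simp: field_simps)
  then have "0 \<le> 2 * ?e / sqrt pi * (?e - sqrt pi * z * erfc z) / (erfc z)\<^sup>2"
    by (intro divide_nonneg_nonneg mult_nonneg_nonneg) auto
  moreover have "((\<lambda>z. exp (- (z\<^sup>2)) / erfc z) has_real_derivative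
      2 * ?e / sqrt pi * (?e - sqrt pi * z * erfc z) / (erfc z)\<^sup>2) (at z)"
    using erfc_pos[of z] unfolding erfc_def
    by (auto intro!: derivative_eq_intros simp: field_simps power2_eq_square)
  ultimately show "\<exists>w. ((\<lambda>z. exp (- (z\<^sup>2)) / erfc z) has_real_derivative w) (at z) \<and> 0 \<le> w"
    by blast
qed

section \<open>Similarity profiles for the heat equation\<close>

text \<open>Both temperatures have the shape \<open>A + B * erf (x / (2 * sqrt (a * t)))\<close>, so
  one set of facts about it serves both phases.\<close>

lemma has_real_derivative_similarity_x:
  assumes "a > 0" "t > 0"
  shows "((\<lambda>y. A + B * erf (y / (2 * sqrt (a * t)))) has_real_derivative
    B * exp (- ((x / (2 * sqrt (a * t)))\<^sup>2)) / sqrt (pi * a * t)) (at x)"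
  using assms
  by (auto intro!: derivative_eq_intros simp: real_sqrt_mult mult_ac)

lemma dx_similarity:
  assumes "a > 0" "t > 0"
  shows "dx (\<lambda>x t. A + B * erf (x / (2 * sqrt (a * t)))) x t =
    B * exp (- ((x / (2 * sqrt (a * t)))\<^sup>2)) / sqrt (pi * a * t)"
  unfolding dx_def by (rule DERIV_imp_deriv[OF has_real_derivative_similarity_x[OF assms]])

text \<open>With the similarity variable \<open>?z\<close>, the time derivative and \<open>a\<close>
  times the second space derivative are both equal to \<open>?r\<close>.\<close>

lemma heat_eq_at_similarity:
  assumes "a > 0" "t > 0"
  shows "heat_eq_at a (\<lambda>x t. A + B * erf (x / (2 * sqrt (a * t)))) x t"
proof -
  let ?u = "\<lambda>x t. A + B * erf (x / (2 * sqrt (a * t)))"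
  let ?z = "x / (2 * sqrt (a * t))"
  let ?r = "- B * exp (- (?z\<^sup>2)) * ?z / (sqrt pi * t)"
  have pos: "a * t > 0"
    using assms by simp
  then have sq: "sqrt (a * t) * sqrt (a * t) = a * t"
    by simp
  have xx: "((\<lambda>y. dx ?u y t) has_real_derivative ?r / a) (at x)"
  proof -
    have deriv: "((\<lambda>y. B * exp (- ((y / c)\<^sup>2)) / d) has_real_derivative
        B * (exp (- ((x / c)\<^sup>2)) * - (2 * (x / c) * (1 / c))) / d) (at x)" if "c \<noteq> 0" "d \<noteq> 0" for c d
      using that by (auto intro!: derivative_eq_intros simp: mult_ac)
    have "((\<lambda>y. B * exp (- ((y / (2 * sqrt (a * t)))\<^sup>2)) / sqrt (pi * a * t))
        has_real_derivative B * (exp (- (?z\<^sup>2)) * - (2 * ?z * (1 / (2 * sqrt (a * t))))) / sqrt (pi * a * t)) (at x)"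
      by (rule deriv) (use assms in auto)
    also have "B * (exp (- (?z\<^sup>2)) * - (2 * ?z * (1 / (2 * sqrt (a * t))))) / sqrt (pi * a * t)
        = - B * exp (- (?z\<^sup>2)) * ?z / (sqrt pi * (sqrt (a * t) * sqrt (a * t)))"
      by (simp add: real_sqrt_mult mult_ac)
    also have "\<dots> = ?r / a" unfolding sq by simp
    finally show ?thesis using assms by (simp add: dx_similarity)
  qed
  have zt: "((\<lambda>\<tau>. x / (2 * sqrt (a * \<tau>))) has_real_derivative - ?z / (2 * t)) (at t)"
  proof -
    have "((\<lambda>\<tau>. x / (2 * sqrt (a * \<tau>))) has_real_derivative
        - x * a / (4 * sqrt (a * t) * (sqrt (a * t) * sqrt (a * t)))) (at t)"
      using assms pos by (auto intro!: derivative_eq_intros simp: field_simps simp del: real_sqrt_mult_self)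
         (use pos in linarith)
    also have "- x * a / (4 * sqrt (a * t) * (sqrt (a * t) * sqrt (a * t))) = - ?z / (2 * t)"
      unfolding sq using assms by simp
    finally show ?thesis .
  qed
  have tt: "((\<lambda>\<tau>. ?u x \<tau>) has_real_derivative ?r) (at t)"
    using DERIV_add[OF DERIV_const[of A] DERIV_cmult[OF has_real_derivative_erf[OF zt], of B]]
    by (simp add: mult_ac)
  have "dx (dx ?u) x t = ?r / a" "dt ?u x t = ?r"
    using DERIV_imp_deriv[OF xx] DERIV_imp_deriv[OF tt] by (simp_all add: dx_def dt_def)
  then show ?thesis
    unfolding heat_eq_at_def
    using has_real_derivative_similarity_x[OF assms] xx tt assms
    by (auto simp: field_differentiable_def)
qed

text \<open>The similarity variable tends to infinity both for large x and for t tending to 0 from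
  the right, so the condition at infinity and the initial condition rest on the same limit of
  \<open>erf\<close>.\<close>

lemma similarity_tendsto_1:
  assumes "a > 0"
  shows "t > 0 \<Longrightarrow> ((\<lambda>x. erf (x / (2 * sqrt (a * t)))) \<longlongrightarrow> 1) at_top"
    and "x > 0 \<Longrightarrow> ((\<lambda>t. erf (x / (2 * sqrt (a * t)))) \<longlongrightarrow> 1) (at_right 0)"
proof -
  show "((\<lambda>x. erf (x / (2 * sqrt (a * t)))) \<longlongrightarrow> 1) at_top" if "t > 0"
  proof (rule filterlim_compose[OF erf_tendsto_1])
    have "filterlim (\<lambda>x. x / c) at_top at_top" if "c > 0" for c :: real
      using that by real_asymp
    then show "filterlim (\<lambda>x. x / (2 * sqrt (a * t))) at_top at_top"
      using assms that by simp
  qed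
  show "((\<lambda>t. erf (x / (2 * sqrt (a * t)))) \<longlongrightarrow> 1) (at_right 0)" if "x > 0"
    by (rule filterlim_compose[OF erf_tendsto_1]) (use assms that in real_asymp)
qed

lemma tendsto_similarity:
  assumes "a > 0" "t > 0"
  shows "((\<lambda>x. A + B * erf (x / (2 * sqrt (a * t)))) \<longlongrightarrow>
      A + B * erf (y / (2 * sqrt (a * t)))) (at y within S)"
  using has_real_derivative_similarity_x[OF assms, THEN DERIV_isCont]
  by (metis continuous_at_imp_continuous_at_within continuous_within)

lemma tendsto_dx_similarity:
  assumes "a > 0" "t > 0"
  shows "((\<lambda>x. dx (\<lambda>x t. A + B * erf (x / (2 * sqrt (a * t)))) x t) \<longlongrightarrow>
      B * exp (- ((y / (2 * sqrt (a * t)))\<^sup>2)) / sqrt (pi * a * t)) (at y within S)"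
  unfolding dx_similarity[OF assms] using assms by (intro tendsto_intros) auto

lemma has_real_derivative_similarity_front:
  assumes "a > 0" "t > 0"
  shows "((\<lambda>t. 2 * c * sqrt (a * t)) has_real_derivative c * sqrt a / sqrt t) (at t)"
proof -
  have "((\<lambda>t. 2 * c * sqrt (a * t)) has_real_derivative c * (a / sqrt a) / sqrt t) (at t)"
    using assms by (auto intro!: derivative_eq_intros simp: real_sqrt_mult field_simps)
  then show ?thesis using assms by (simp add: real_div_sqrt)
qed

section \<open>From the scalar equations to the free boundary problem\<close>

lemma theta1_temperature_eq:
  assumes "\<xi> \<noteq> 0"
  shows "theta1_temperature P D \<xi> =
    (\<lambda>x t. - D + D / erf \<xi> * erf (x / (2 * sqrt (alpha1 P * t))))"
  by (intro ext) (simp add: theta1_temperature_def algebra_simps)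

lemma theta2_sim_eq:
  assumes "\<mu> > 0"
  shows "theta2_sim P \<mu> =
    (\<lambda>x t. - (th0 P * erf \<mu> / erfc \<mu>) + th0 P / erfc \<mu> * erf (x / (2 * sqrt (alpha2 P * t))))"
  using erf_pos[OF assms] by (intro ext) (simp add: theta2_sim_def algebra_simps)

lemma alpha_pos:
  assumes "admissible P"
  shows "alpha1 P > 0" "alpha2 P > 0" "alpha12 P > 0"
  using assms by (auto simp: admissible_def alpha1_def alpha2_def alpha12_def)

text \<open>Temperature gradients at the fronts and front velocities scale like
  \<open>1 / sqrt t\<close>, front positions like \<open>sqrt t\<close>. After removing these
  factors the two interface conditions are the time-free equations \<open>stefan\<close> and
  \<open>mushy\<close>; everything else holds for any positive parameters of the profiles.\<close>

lemma common_equations_similarity: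
  assumes "admissible P" "\<xi> > 0" "\<mu> > 0"
    and stefan: "k1 P * (D * exp (- (\<xi>\<^sup>2)) / (erf \<xi> * sqrt (pi * alpha1 P)))
        - k2 P * (th0 P * exp (- (\<mu>\<^sup>2)) / (erfc \<mu> * sqrt (pi * alpha2 P)))
      = rho P * lh P * (eps P * (\<xi> * sqrt (alpha1 P)) + (1 - eps P) * (\<mu> * sqrt (alpha2 P)))"
    and mushy: "D * exp (- (\<xi>\<^sup>2)) / (erf \<xi> * sqrt (pi * alpha1 P))
        * (2 * (\<mu> * sqrt (alpha2 P) - \<xi> * sqrt (alpha1 P))) = gam P"
  shows "common_equations P (theta1_temperature P D \<xi>, theta2_sim P \<mu>, s_sim P \<xi>, r_sim P \<mu>)"
proof -
  let ?s = "s_sim P \<xi>" and ?r = "r_sim P \<mu>"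
  let ?A2 = "- (th0 P * erf \<mu> / erfc \<mu>)" and ?B2 = "th0 P / erfc \<mu>"
  note a = alpha_pos[OF assms(1)]
  note pos = erf_pos[OF \<open>\<xi> > 0\<close>] erf_pos[OF \<open>\<mu> > 0\<close>] erfc_pos[of \<mu>]
  have th1: "theta1_temperature P D \<xi> =
      (\<lambda>x t. - D + D / erf \<xi> * erf (x / (2 * sqrt (alpha1 P * t))))"
    using assms by (simp add: theta1_temperature_eq)
  note th2 = theta2_sim_eq[OF \<open>\<mu> > 0\<close>, of P]
  \<comment> \<open>On each front the similarity variable is constant in time.\<close>
  have sz: "?s t / (2 * sqrt (alpha1 P * t)) = \<xi>" and rz: "?r t / (2 * sqrt (alpha2 P * t)) = \<mu>"
    if "t > 0" for t
    using a that by (simp_all add: s_sim_def r_sim_def)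
  have s0: "(?s \<longlongrightarrow> 0) (at_right 0)" "(?r \<longlongrightarrow> 0) (at_right 0)"
    unfolding s_sim_def[abs_def] r_sim_def[abs_def] by (auto intro!: tendsto_eq_intros)
  have ds: "(?s has_real_derivative \<xi> * sqrt (alpha1 P) / sqrt t) (at t)"
    and dr: "(?r has_real_derivative \<mu> * sqrt (alpha2 P) / sqrt t) (at t)" if "t > 0" for t
    using has_real_derivative_similarity_front a that by (simp_all add: s_sim_def[abs_def] r_sim_def[abs_def])
  have diff: "?s field_differentiable (at t)" "?r field_differentiable (at t)" if "t > 0" for t
    using ds[OF that] dr[OF that] unfolding field_differentiable_def by blast+
  have lim1: "((\<lambda>x. theta1_temperature P D \<xi> x t) \<longlongrightarrow> 0) (at_left (?s t))" if "t > 0" for t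
    using tendsto_similarity[OF a(1) that, of "- D" "D / erf \<xi>" "?s t"] pos
    by (simp add: th1 sz that)
  have lim2: "((\<lambda>x. theta2_sim P \<mu> x t) \<longlongrightarrow> 0) (at_right (?r t))" if "t > 0" for t
    using tendsto_similarity[OF a(2) that, of ?A2 ?B2 "?r t"] pos
    by (simp add: th2 rz that)
  \<comment> \<open>The factor \<open>1\<close> stands for the limit of \<open>erf\<close>; in this
    form \<open>tendsto_intros\<close> matches the goal below.\<close>
  have th0: "?A2 + ?B2 * 1 = th0 P"
  proof -
    have "?A2 + ?B2 * 1 = th0 P * erfc \<mu> / erfc \<mu>"
      unfolding erfc_def by (simp add: diff_divide_distrib right_diff_distrib)
    then show ?thesis using pos by simp
  qed
  have ini: "((\<lambda>t. theta2_sim P \<mu> x t) \<longlongrightarrow> th0 P) (at_right 0)" if "x > 0" for x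
    unfolding th2 using similarity_tendsto_1(2)[OF a(2) that]
    by (subst th0[symmetric]) (intro tendsto_intros)
  have inf: "((\<lambda>x. theta2_sim P \<mu> x t) \<longlongrightarrow> th0 P) at_top" if "t > 0" for t
    unfolding th2 using similarity_tendsto_1(1)[OF a(2) that]
    by (subst th0[symmetric]) (intro tendsto_intros)
  have flux: "\<exists>a b. ((\<lambda>x. dx (theta1_temperature P D \<xi>) x t) \<longlongrightarrow> a) (at_left (?s t)) \<and>
      ((\<lambda>x. dx (theta2_sim P \<mu>) x t) \<longlongrightarrow> b) (at_right (?r t)) \<and>
      k1 P * a - k2 P * b = rho P * lh P * (eps P * deriv ?s t + (1 - eps P) * deriv ?r t) \<and>
      a * (?r t - ?s t) = gam P" if t: "t > 0" for t
  proof (intro exI conjI)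
    let ?a = "D * exp (- (\<xi>\<^sup>2)) / (erf \<xi> * sqrt (pi * alpha1 P))"
    let ?b = "th0 P * exp (- (\<mu>\<^sup>2)) / (erfc \<mu> * sqrt (pi * alpha2 P))"
    show "((\<lambda>x. dx (theta1_temperature P D \<xi>) x t) \<longlongrightarrow> ?a / sqrt t) (at_left (?s t))"
      using tendsto_dx_similarity[OF a(1) t, of "- D" "D / erf \<xi>" "?s t"]
      unfolding th1 sz[OF t] by (simp add: real_sqrt_mult mult_ac)
    show "((\<lambda>x. dx (theta2_sim P \<mu>) x t) \<longlongrightarrow> ?b / sqrt t) (at_right (?r t))"
      using tendsto_dx_similarity[OF a(2) t, of ?A2 ?B2 "?r t"]
      unfolding th2 rz[OF t] by (simp add: real_sqrt_mult mult_ac)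
    have "k1 P * (?a / sqrt t) - k2 P * (?b / sqrt t) = (k1 P * ?a - k2 P * ?b) / sqrt t"
      by (simp add: diff_divide_distrib)
    also have "\<dots> = rho P * lh P * (eps P * deriv ?s t + (1 - eps P) * deriv ?r t)"
      unfolding stefan DERIV_imp_deriv[OF ds[OF t]] DERIV_imp_deriv[OF dr[OF t]]
      by (simp add: add_divide_distrib distrib_left)
    finally show "k1 P * (?a / sqrt t) - k2 P * (?b / sqrt t) = \<dots>" .
    have rs: "?r t - ?s t = 2 * (\<mu> * sqrt (alpha2 P) - \<xi> * sqrt (alpha1 P)) * sqrt t"
      by (simp add: s_sim_def r_sim_def real_sqrt_mult algebra_simps)
    \<comment> \<open>The decay of the gradient compensates the growth of the mushy zone's
      width.\<close>
    have "a / sqrt t * (b * sqrt t) = a * b" for a b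
      using t by simp
    from this[of ?a] show "?a / sqrt t * (?r t - ?s t) = gam P"
      unfolding rs mushy[symmetric] .
  qed
  have heat: "heat_eq_at (alpha1 P) (theta1_temperature P D \<xi>) x t"
    "heat_eq_at (alpha2 P) (theta2_sim P \<mu>) x t" if "t > 0" for x t
    unfolding th1 th2 by (rule heat_eq_at_similarity[OF a(1) that] heat_eq_at_similarity[OF a(2) that])+
  show ?thesis
    unfolding common_equations_def prod.case
    by (intro conjI allI impI; (rule s0 | (rule heat lim1 lim2 ini inf flux diff, assumption)))
qed

text \<open>This relates the coefficient of the Mills ratio in \<open>F0\<close> and
  \<open>F\<close> to the factor \<open>sqrt (alpha12 P)\<close> in its argument.\<close>

lemma sqrt_alpha12:
  assumes "admissible P"
  shows "sqrt (alpha12 P) = sqrt (k2 P * c2 P) / sqrt (k1 P * c1 P) * k1 P / k2 P"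
  using assms
  by (intro real_sqrt_unique)
     (auto simp: admissible_def alpha12_def alpha1_def alpha2_def power_mult_distrib power_divide
       field_simps power2_eq_square[of "k1 P"] power2_eq_square[of "k2 P"])

lemma W0_greater:
  assumes "admissible P" "D0 > 0" "x > 0"
  shows "W0 P D0 x > x"
  using assms erf_pos[of x] by (simp add: W0_def admissible_def)

text \<open>The definition of \<open>W0\<close> encodes the mushy zone condition, and the equation
  for \<xi> is the Stefan condition up to a constant factor.\<close>

lemma common_equations_temperature:
  assumes P: "admissible P" and "D0 > 0" "\<xi> > 0" and eq: "xi_eq_temperature P D0 \<xi>"
  shows "common_equations P (sim_solution_temperature P D0 \<xi>)"
proof -
  define \<mu> where "\<mu> = sqrt (alpha12 P) * W0 P D0 \<xi>"
  note a = alpha_pos[OF P]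
  note e = erf_pos[OF \<open>\<xi> > 0\<close>]
  have pos: "rho P > 0" "k1 P > 0" "k2 P > 0" "c1 P > 0" "c2 P > 0"
    using P by (auto simp: admissible_def)
  have W: "W0 P D0 \<xi> > \<xi>"
    using W0_greater P assms by blast
  then have mu: "\<mu> > 0" using a assms by (simp add: \<mu>_def)
  have mua: "\<mu> * sqrt (alpha2 P) = sqrt (alpha1 P) * W0 P D0 \<xi>"
    using a by (simp add: \<mu>_def alpha12_def real_sqrt_divide)
  define q where "q = sqrt (k2 P * c2 P) / sqrt (k1 P * c1 P)"
  define E where "E = exp (- (\<mu>\<^sup>2)) / erfc \<mu>"
  have "sqrt (alpha1 P) / sqrt (alpha2 P) = q * k1 P / k2 P"
    using sqrt_alpha12[OF P] by (simp add: q_def alpha12_def real_sqrt_divide)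
  \<comment> \<open>This lets the fluxes of the two phases share the factor
    \<open>k1 P / sqrt (alpha1 P)\<close>, leaving the left side of \<open>F\<close>.\<close>
  then have r: "k1 P * q / sqrt (alpha1 P) = k2 P / sqrt (alpha2 P)"
    using a pos by (simp add: field_simps)
  have "alpha1 P = sqrt (alpha1 P) * sqrt (alpha1 P)"
    using a by simp
  then have c1: "k1 P / (sqrt (alpha1 P) * c1 P) = rho P * sqrt (alpha1 P)"
    using a pos by (simp add: alpha1_def field_simps del: real_sqrt_mult_self)
  have "exp (- (\<xi>\<^sup>2)) / erf \<xi> - th0 P / D0 * q * E = lh P * sqrt pi / (D0 * c1 P) * G0 P D0 \<xi>"
    using eq a
    by (simp add: xi_eq_temperature_def F0_def \<mu>_def power_mult_distrib q_def E_def mult_ac)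
  from arg_cong[where f = "(*) D0", OF this]
  have F: "D0 * (exp (- (\<xi>\<^sup>2)) / erf \<xi>) - th0 P * q * E = lh P * sqrt pi / c1 P * G0 P D0 \<xi>"
    using \<open>D0 > 0\<close> by (simp add: right_diff_distrib)
  have "k1 P * (D0 * exp (- (\<xi>\<^sup>2)) / (erf \<xi> * sqrt (pi * alpha1 P)))
        - k2 P * (th0 P * exp (- (\<mu>\<^sup>2)) / (erfc \<mu> * sqrt (pi * alpha2 P)))
      = k1 P / sqrt (alpha1 P) * (D0 * (exp (- (\<xi>\<^sup>2)) / erf \<xi>)) / sqrt pi
        - k2 P / sqrt (alpha2 P) * (th0 P * E) / sqrt pi"
    by (simp add: E_def real_sqrt_mult mult_ac)
  also have "\<dots> = k1 P / sqrt (alpha1 P) * (D0 * (exp (- (\<xi>\<^sup>2)) / erf \<xi>) - th0 P * q * E) / sqrt pi"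
    unfolding r[symmetric] by (simp add: diff_divide_distrib right_diff_distrib)
  also have "\<dots> = k1 P / (sqrt (alpha1 P) * c1 P) * lh P * G0 P D0 \<xi>"
    unfolding F by simp
  \<comment> \<open>\<open>G0\<close> is the average of \<xi> and \<open>W0 P D0 \<xi>\<close> with
    weights \<open>eps P\<close> and \<open>1 - eps P\<close>, which are the weights of the two
    front velocities.\<close>
  also have "\<dots> = rho P * lh P * (eps P * (\<xi> * sqrt (alpha1 P)) + (1 - eps P) * (\<mu> * sqrt (alpha2 P)))"
    unfolding c1 mua by (simp add: G0_def W0_def algebra_simps)
  finally have stefan: "k1 P * (D0 * exp (- (\<xi>\<^sup>2)) / (erf \<xi> * sqrt (pi * alpha1 P)))
        - k2 P * (th0 P * exp (- (\<mu>\<^sup>2)) / (erfc \<mu> * sqrt (pi * alpha2 P))) = \<dots>" .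
  \<comment> \<open>The factor \<open>exp (\<xi>\<^sup>2) * erf \<xi>\<close> of this width cancels
    against the gradient of the solid phase.\<close>
  have "\<mu> * sqrt (alpha2 P) - \<xi> * sqrt (alpha1 P) =
      sqrt (alpha1 P) * (gam P * sqrt pi / (2 * D0) * exp (\<xi>\<^sup>2) * erf \<xi>)"
    unfolding mua by (simp add: W0_def algebra_simps)
  then have "D0 * exp (- (\<xi>\<^sup>2)) / (erf \<xi> * sqrt (pi * alpha1 P))
        * (2 * (\<mu> * sqrt (alpha2 P) - \<xi> * sqrt (alpha1 P))) = gam P"
    using a e \<open>D0 > 0\<close> by (simp add: real_sqrt_mult exp_minus field_simps)
  from common_equations_similarity[OF P \<open>\<xi> > 0\<close> mu stefan this] show ?thesis
    by (simp add: sim_solution_temperature_def Let_def \<mu>_def)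
qed

lemma theta1_temperature_at_0:
  assumes "admissible P" "t > 0" "\<xi> > 0"
  shows "((\<lambda>x. theta1_temperature P D \<xi> x t) \<longlongrightarrow> - D) (at_right 0)"
    and "((\<lambda>x. dx (theta1_temperature P D \<xi>) x t) \<longlongrightarrow> D / (erf \<xi> * sqrt (pi * alpha1 P * t))) (at_right 0)"
  using tendsto_similarity[OF alpha_pos(1)[OF assms(1)] assms(2), of "- D" "D / erf \<xi>" 0]
    tendsto_dx_similarity[OF alpha_pos(1)[OF assms(1)] assms(2), of "- D" "D / erf \<xi>" 0] assms(3)
  by (simp_all add: theta1_temperature_eq)

section \<open>Monotonicity and the value at zero of the convective equation\<close>

text \<open>Strictness is drawn from the linear term of \<open>G\<close>; \<open>F\<close>
  contributes a weak inequality. The range includes 0, where the positive \<open>q\<close> keeps the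
  first denominator of \<open>F\<close> away from zero.\<close>

lemma xi_eq_convective_gap_strict_antimono:
  assumes P: "admissible P" and "Dinf > 0" "h0 > 0" "0 \<le> x" "x < y"
  defines "gap \<equiv> \<lambda>x. F P Dinf h0 x - lh P * sqrt pi / (Dinf * c1 P) * G P Dinf h0 x"
  shows "gap y < gap x"
proof -
  define q where "q = k1 P / (h0 * sqrt (alpha1 P * pi))"
  note a = alpha_pos[OF P]
  have pos: "rho P > 0" "k1 P > 0" "k2 P > 0" "c1 P > 0" "c2 P > 0" "gam P > 0" "lh P > 0"
      "th0 P > 0" "eps P < 1"
    using P by (auto simp: admissible_def)
  have q: "q > 0" using a pos assms by (simp add: q_def)
  have ex: "erf x \<ge> 0" using erf_pos[of x] \<open>0 \<le> x\<close> by (cases "x = 0") auto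
  have exy: "erf x < erf y" using \<open>x < y\<close> by (rule erf_strict_mono)
  have sq: "x\<^sup>2 \<le> y\<^sup>2" using assms by simp
  have prod: "exp (x\<^sup>2) * (erf x + q) \<le> exp (y\<^sup>2) * (erf y + q)"
    using q ex exy sq by (intro mult_mono) auto
  have W: "W P Dinf h0 x \<le> W P Dinf h0 y"
    unfolding W_def q_def[symmetric] mult.assoc using prod \<open>x < y\<close> pos \<open>Dinf > 0\<close>
    by (intro add_mono mult_left_mono) auto
  have G: "G P Dinf h0 x < G P Dinf h0 y"
    unfolding G_def q_def[symmetric] mult.assoc using prod \<open>x < y\<close> pos \<open>Dinf > 0\<close>
    by (intro add_less_le_mono mult_left_mono) auto
  have W0: "0 \<le> W P Dinf h0 x"
    unfolding W_def q_def[symmetric] using q ex pos \<open>0 \<le> x\<close> \<open>Dinf > 0\<close> by simp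
  have "exp (- ((sqrt (alpha12 P) * W P Dinf h0 x)\<^sup>2)) / erfc (sqrt (alpha12 P) * W P Dinf h0 x)
      \<le> exp (- ((sqrt (alpha12 P) * W P Dinf h0 y)\<^sup>2)) / erfc (sqrt (alpha12 P) * W P Dinf h0 y)"
    using W W0 a by (intro exp_div_erfc_mono mult_left_mono mult_nonneg_nonneg) auto
  moreover have "exp (- (y\<^sup>2)) / (erf y + q) \<le> exp (- (x\<^sup>2)) / (erf x + q)"
    using q ex exy sq by (intro frac_le) auto
  ultimately have F: "F P Dinf h0 y \<le> F P Dinf h0 x"
    unfolding F_def q_def[symmetric] using a pos \<open>Dinf > 0\<close>
    by (intro diff_mono mult_left_mono) (auto simp: power_mult_distrib)
  have "lh P * sqrt pi / (Dinf * c1 P) * G P Dinf h0 x < lh P * sqrt pi / (Dinf * c1 P) * G P Dinf h0 y"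
    using G pos \<open>Dinf > 0\<close> by (intro mult_strict_left_mono) auto
  with F show ?thesis by (simp add: gap_def)
qed

text \<open>Each of the three terms is nondecreasing, the middle one because \<open>- 1 / x\<close>
  increases on x > 0.\<close>

lemma F3_mono:
  assumes P: "admissible P" and "0 < x" "x \<le> y"
  shows "F3 P x \<le> F3 P y"
proof -
  have "gam P > 0" "k1 P > 0" "k2 P > 0" "c2 P > 0" "lh P > 0" "th0 P > 0" "eps P < 1"
    using P by (auto simp: admissible_def)
  then show ?thesis
    unfolding F3_def using assms
    by (intro add_mono diff_mono mult_left_mono exp_div_erfc_mono) (auto simp: frac_le)
qed

text \<open>At 0 the functions collapse: \<open>W\<close> is a multiple \<open>w\<close> of
  \<open>q\<close>, \<open>G\<close> is \<open>(1 - eps P) * w\<close>, and the first term of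
  \<open>F\<close> is \<open>1 / q\<close>, again expressible by \<open>w\<close>. The three
  resulting terms are those of \<open>F3\<close> at \<open>z\<close>.\<close>

lemma convective_gap_at_0:
  assumes P: "admissible P" and "Dinf > 0" "h0 > 0"
  shows "F P Dinf h0 0 - lh P * sqrt pi / (Dinf * c1 P) * G P Dinf h0 0 =
    - (th0 P * sqrt (k2 P * c2 P) / (Dinf * sqrt (k1 P * c1 P))) * F3 P (sqrt (alpha12 P) * W P Dinf h0 0)"
proof -
  define w where "w = W P Dinf h0 0"
  define r where "r = sqrt (k2 P * c2 P) / sqrt (k1 P * c1 P)"
  define q where "q = k1 P / (h0 * sqrt (alpha1 P * pi))"
  define z where "z = sqrt (alpha12 P) * w"
  define E where "E = exp (- (z\<^sup>2)) / erfc z"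
  note a = alpha_pos[OF P]
  have pos: "rho P > 0" "k1 P > 0" "k2 P > 0" "c1 P > 0" "c2 P > 0" "gam P > 0" "lh P > 0" "th0 P > 0"
    using P by (auto simp: admissible_def)
  have q: "q > 0" using a pos assms by (simp add: q_def)
  have w: "w = gam P * sqrt pi / (2 * Dinf) * q"
    by (simp add: w_def W_def q_def)
  then have w0: "w > 0" using q pos assms by simp
  have r0: "r > 0" using pos by (simp add: r_def)
  have sa: "sqrt (alpha12 P) = r * k1 P / k2 P"
    using sqrt_alpha12[OF P] by (simp add: r_def)
  have "r * r = k2 P * c2 P / (k1 P * c1 P)"
    using pos by (simp add: r_def)
  \<comment> \<open>This exchanges the \<open>c2 P\<close> of \<open>F3\<close> for the
    \<open>c1 P\<close> of the convective equation.\<close>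
  then have rr: "r * sqrt (alpha12 P) = c2 P / c1 P"
    unfolding sa using pos by (simp add: field_simps)
  have F: "F P Dinf h0 0 = gam P * sqrt pi / (2 * Dinf * w) - th0 P / Dinf * r * E"
    using a q pos \<open>Dinf > 0\<close>
    unfolding F_def q_def[symmetric] w_def[symmetric]
    by (simp add: E_def z_def power_mult_distrib r_def) (simp add: w)
  have G: "G P Dinf h0 0 = (1 - eps P) * w"
    by (simp add: G_def w_def W_def)
  have t1: "th0 P / Dinf * r * (gam P * k1 P * sqrt pi / (2 * th0 P * k2 P) * (1 / z))
      = gam P * sqrt pi / (2 * Dinf * w)"
    unfolding z_def sa using r0 w0 pos \<open>Dinf > 0\<close> by (simp add: field_simps)
  have "th0 P / Dinf * r * ((1 - eps P) * lh P * sqrt pi / (th0 P * c2 P) * z)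
      = (r * sqrt (alpha12 P)) * (1 - eps P) * lh P * sqrt pi * w / (Dinf * c2 P)"
    unfolding z_def using pos by simp
  also have "\<dots> = lh P * sqrt pi / (Dinf * c1 P) * ((1 - eps P) * w)"
    unfolding rr using pos by (simp add: mult_ac)
  finally have t2: "th0 P / Dinf * r * ((1 - eps P) * lh P * sqrt pi / (th0 P * c2 P) * z) = \<dots>" .
  have "- (th0 P / Dinf * r) * F3 P z =
      - (th0 P / Dinf * r * E)
      + th0 P / Dinf * r * (gam P * k1 P * sqrt pi / (2 * th0 P * k2 P) * (1 / z))
      - th0 P / Dinf * r * ((1 - eps P) * lh P * sqrt pi / (th0 P * c2 P) * z)"
    unfolding F3_def E_def[symmetric] by (simp only: ring_distribs) simp
  then show ?thesis
    unfolding t1 t2 F G w_def[symmetric] z_def[symmetric] by (simp add: r_def)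
qed

section \<open>Coincidence of the two solutions and the bound on \<open>erf\<close>\<close>

theorem theorem3p2:
  fixes P :: mushy_data and D0 Dinf h0 xi_star eta :: real
  assumes "admissible P"
    and "D0 > 0" and "Dinf > D0"
    and "xi_star > 0" and "xi_eq_temperature P D0 xi_star"
    and "eta > 0" and "F3 P eta = 0"
    and "h0 = k1 P * D0 / (sqrt (pi * alpha1 P) * (Dinf - D0) * erf xi_star)"
  shows "h0 > 0 \<and>
    solves_temperature_problem P D0 (sim_solution_temperature P D0 xi_star) \<and>
    (\<exists>xi. xi > 0 \<and> xi_eq_convective P Dinf h0 xi \<and>
       (\<forall>y>0. xi_eq_convective P Dinf h0 y \<longrightarrow> y = xi) \<and>
       solves_convective_problem P Dinf h0 (sim_solution_convective P Dinf h0 xi) \<and>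
       coincide (sim_solution_temperature P D0 xi_star)
                (sim_solution_convective P Dinf h0 xi)) \<and>
    erf xi_star < min 1 (2 * Dinf * D0 * eta / (gam P * (Dinf - D0) * sqrt (pi * alpha12 P)))"
proof -
  define \<xi> where "\<xi> = xi_star"
  define q where "q = k1 P / (h0 * sqrt (alpha1 P * pi))"
  note P = \<open>admissible P\<close>
  note a = alpha_pos[OF P]
  have pos: "k1 P > 0" "k2 P > 0" "c1 P > 0" "c2 P > 0" "gam P > 0" "th0 P > 0"
    using P by (auto simp: admissible_def)
  have Dinf: "Dinf > 0" "Dinf - D0 > 0" using assms by simp_all
  have \<xi>: "\<xi> > 0" using assms by (simp add: \<xi>_def)
  note e = erf_pos[OF \<xi>]
  have h0: "h0 = k1 P * D0 / (sqrt (pi * alpha1 P) * (Dinf - D0) * erf \<xi>)"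
    using assms by (simp add: \<xi>_def)
  then have h0_pos: "h0 > 0" using a pos e Dinf \<open>D0 > 0\<close> by simp
  have q: "q = (Dinf - D0) * erf \<xi> / D0"
    using a pos e Dinf \<open>D0 > 0\<close> by (simp add: q_def h0 mult.commute[of pi])
  have eq: "erf \<xi> + q = Dinf * erf \<xi> / D0"
    using \<open>D0 > 0\<close> by (simp add: q field_simps)
  have W: "W P Dinf h0 \<xi> = W0 P D0 \<xi>" and G: "G P Dinf h0 \<xi> = G0 P D0 \<xi>"
    using Dinf \<open>D0 > 0\<close> by (simp_all add: W_def W0_def G_def G0_def q_def[symmetric] eq)
  \<comment> \<open>The coefficient in front of \<open>G\<close> carries the same factor relative to
    that of \<open>G0\<close>, so at \<xi> the convective equation is the temperature equation times
    \<open>D0 / Dinf\<close>.\<close>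
  have F: "F P Dinf h0 \<xi> = D0 / Dinf * F0 P D0 \<xi>"
    unfolding F_def F0_def W q_def[symmetric] eq
    using Dinf \<open>D0 > 0\<close> by (simp add: right_diff_distrib mult_ac)
  define gap where "gap = (\<lambda>x. F P Dinf h0 x - lh P * sqrt pi / (Dinf * c1 P) * G P Dinf h0 x)"
  have anti: "gap y < gap x" if "0 \<le> x" "x < y" for x y
    unfolding gap_def
    using xi_eq_convective_gap_strict_antimono[OF P Dinf(1) h0_pos that] .
  have gap_iff: "xi_eq_convective P Dinf h0 x \<longleftrightarrow> gap x = 0" for x
    by (simp add: xi_eq_convective_def gap_def)
  have xi_eq: "xi_eq_convective P Dinf h0 \<xi>"
    unfolding xi_eq_convective_def F G using assms(5) Dinf \<open>D0 > 0\<close>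
    by (simp add: xi_eq_temperature_def \<xi>_def)
  then have gap0: "gap \<xi> = 0" by (simp add: gap_iff)
  have unique: "y = \<xi>" if "y > 0" "xi_eq_convective P Dinf h0 y" for y
    using anti[of y \<xi>] anti[of \<xi> y] that gap0 \<xi>
    by (cases y \<xi> rule: linorder_cases) (auto simp: gap_iff)
  \<comment> \<open>The amplitude of the convective profile becomes \<open>D0\<close>, by
    \<open>eq\<close> again.\<close>
  have amp: "Dinf * erf \<xi> / (erf \<xi> + k1 P / (h0 * sqrt (pi * alpha1 P))) = D0"
    using eq e Dinf \<open>D0 > 0\<close> by (simp add: q_def mult.commute[of pi])
  have same: "sim_solution_convective P Dinf h0 \<xi> = sim_solution_temperature P D0 \<xi>"
    unfolding sim_solution_convective_def sim_solution_temperature_def W Let_def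
    by (auto simp: theta1_convective_def theta1_temperature_def amp fun_eq_iff)
  have common: "common_equations P (sim_solution_temperature P D0 \<xi>)"
    using common_equations_temperature[OF P \<open>D0 > 0\<close> \<xi>] assms(5) by (simp add: \<xi>_def)
  have temp: "solves_temperature_problem P D0 (sim_solution_temperature P D0 \<xi>)"
    using common theta1_temperature_at_0(1)[OF P _ \<xi>]
    by (simp add: solves_temperature_problem_def sim_solution_temperature_def Let_def)
  \<comment> \<open>With the face temperature \<open>- D0\<close>, the convective condition is
    linear in \<open>h0\<close>; solving it gives the prescribed value of \<open>h0\<close>.\<close>
  have robin: "k1 P * (D0 / (erf \<xi> * sqrt (pi * alpha1 P * t))) = h0 / sqrt t * (- D0 + Dinf)"
    if "t > 0" for t
    using Dinf by (simp add: h0 real_sqrt_mult)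
  have conv: "solves_convective_problem P Dinf h0 (sim_solution_convective P Dinf h0 \<xi>)"
    using common theta1_temperature_at_0[OF P _ \<xi>] robin
    unfolding same solves_convective_problem_def sim_solution_temperature_def Let_def prod.case
    by blast
  have coincide: "coincide (sim_solution_temperature P D0 \<xi>) (sim_solution_convective P Dinf h0 \<xi>)"
    unfolding same by (simp add: coincide_def split: prod.split)
  have "erf \<xi> < 2 * Dinf * D0 * eta / (gam P * (Dinf - D0) * sqrt (pi * alpha12 P))"
  proof -
    define z where "z = sqrt (alpha12 P) * W P Dinf h0 0"
    have "W P Dinf h0 0 = gam P * sqrt pi / (2 * Dinf) * q"
      by (simp add: W_def q_def)
    then have z: "z = gam P * (Dinf - D0) * sqrt (pi * alpha12 P) * erf \<xi> / (2 * Dinf * D0)"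
      by (simp add: z_def q real_sqrt_mult)
    \<comment> \<open>Existence of a positive root becomes a condition on \<open>q\<close> through
      the sign at 0.\<close>
    have "0 < gap 0" using anti[of 0 \<xi>] \<xi> gap0 by simp
    moreover have "gap 0 = - (th0 P * sqrt (k2 P * c2 P) / (Dinf * sqrt (k1 P * c1 P))) * F3 P z"
      unfolding gap_def z_def by (rule convective_gap_at_0[OF P Dinf(1) h0_pos])
    moreover have "th0 P * sqrt (k2 P * c2 P) / (Dinf * sqrt (k1 P * c1 P)) > 0"
      using pos Dinf by simp
    ultimately have "F3 P z < 0"
      by (metis mult_minus_left neg_0_less_iff_less zero_less_mult_pos mult_minus_right)
    \<comment> \<open>Otherwise monotonicity would force \<open>F3 P z\<close> to be at least
      \<open>F3 P eta = 0\<close>. Since \<open>z\<close> is a multiple of \<open>erf \<xi>\<close>,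
      solving for the latter gives the bound.\<close>
    then have "z < eta"
      using F3_mono[OF P \<open>eta > 0\<close>, of z] \<open>F3 P eta = 0\<close> by linarith
    then show ?thesis
      unfolding z using a pos Dinf \<open>D0 > 0\<close> by (simp add: field_simps)
  qed
  then show ?thesis
    unfolding \<xi>_def[symmetric] min_less_iff_conj
    using h0_pos temp \<xi> xi_eq unique conv coincide erf_less_1[of \<xi>] by blast
qed

end
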